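(* Let $n\ge 2$ be an integer and let $G$ be the graph obtained by fully subdividing the complete graph $K_n$ on $n$ vertices. Then $$\frac{\lceil \log_2 \log_2 n \rceil + 1}{2} \leq \mathrm{box}(G) \leq \lceil \log_2 \log_2 n \rceil + 2.$$
   Context: A graph $G$ is obtained by fully subdividing $H$ if $G$ results from subdividing every edge of $H$ exactly once, i.e. each edge $\{u,v\}$ of $H$ is replaced by a path $u,w,v$ with a new vertex $w$ (a different new vertex for each edge). For a positive integer $k$, a $k$-box is a Cartesian product $R_1\times\cdots\times R_k\subseteq\mathbb{R}^k$ of closed intervals $R_i=[a_i,b_i]$. The boxicity $\mathrm{box}(G)$ of a finite simple graph $G$ is the minimum positive integer $k$ such that one can assign to each vertex of $G$ a $k$-box so that two distinct vertices are adjacent if and only if their boxes have non-empty intersection (in particular complete graphs have boxicity $1$). *)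

theory Defs
  imports Complex_Main "HOL-Library.FuncSet" "Graph_Theory.Graph_Theory"
begin

text \<open>
  Finite simple graphs are the finite, symmetric, loop-free digraphs \<open>pair_graph\<close> of
  \<open>Graph_Theory\<close>: an undirected edge \<open>{u, v}\<close> is the pair of arcs \<open>(u, v)\<close>, \<open>(v, u)\<close>.
\<close>

definition uedges :: "'a pair_pre_digraph \<Rightarrow> 'a set set" where
  "uedges G = {{u, v} | u v. (u, v) \<in> parcs G}"

text \<open>
  \<open>w e\<close> is the new vertex of the edge \<open>e\<close>; an edge \<open>e = {u, v}\<close> becomes the path \<open>u, w e, v\<close>.
\<close>

definition full_subdivision :: "'a pair_pre_digraph \<Rightarrow> 'a pair_pre_digraph \<Rightarrow> bool" where
  "full_subdivision H G \<longleftrightarrow>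
    (\<exists>w :: 'a set \<Rightarrow> 'a.
       inj_on w (uedges H) \<and>
       w ` uedges H \<inter> pverts H = {} \<and>
       pverts G = pverts H \<union> w ` uedges H \<and>
       parcs G = (\<Union>e \<in> uedges H. e \<times> {w e} \<union> {w e} \<times> e))"

text \<open>
  Points of $k$-dimensional space are the functions \<open>nat \<Rightarrow> real\<close> that are \<open>undefined\<close>
  outside \<open>{..<k}\<close>, since \<open>k\<close> has to vary in the definition of boxicity.
\<close>

definition is_box :: "nat \<Rightarrow> (nat \<Rightarrow> real) set \<Rightarrow> bool" where
  "is_box k R \<longleftrightarrow>
    (\<exists>a b. (\<forall>i<k. a i \<le> b i) \<and> R = (\<Pi>\<^sub>E i\<in>{..<k}. {a i..b i}))"

definition box_representation ::
    "nat \<Rightarrow> 'a pair_pre_digraph \<Rightarrow> ('a \<Rightarrow> (nat \<Rightarrow> real) set) \<Rightarrow> bool" where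
  "box_representation k G R \<longleftrightarrow>
    (\<forall>v \<in> pverts G. is_box k (R v)) \<and>
    (\<forall>u \<in> pverts G. \<forall>v \<in> pverts G. u \<noteq> v \<longrightarrow>
       ((u, v) \<in> parcs G \<longleftrightarrow> R u \<inter> R v \<noteq> {}))"

definition boxicity :: "'a pair_pre_digraph \<Rightarrow> nat" where
  "boxicity G = (LEAST k. 0 < k \<and> (\<exists>R. box_representation k G R))"

end

theory Submission
  imports Defs
begin

text \<open>
  Lower bound: in a \<open>k\<close>-box representation the left and right endpoints give \<open>2k\<close> orders on the
  original vertices.  If \<open>n > 2 ^ 2 ^ (2k - 1)\<close>, the Erd\H{o}s--Szekeres theorem, applied once for
  each order but the first, yields vertices \<open>x, y, z\<close> with \<open>y\<close> between \<open>x\<close> and \<open>z\<close> in every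
  order.  A box meeting those of \<open>x\<close> and \<open>z\<close>, in particular that of the subdivision vertex of
  \<open>{x, z}\<close>, then meets the box of \<open>y\<close>.

  Upper bound: with \<open>n \<le> 2 ^ 2 ^ m\<close>, there are \<open>m + 1\<close> placements of the vertices on the line such
  that of any three vertices each one is, in some placement, strictly outside the hull of the other
  two.  Original vertices are points and subdivision vertices are hulls of two points in these
  dimensions; one more dimension makes the subdivision vertices disjoint.
\<close>

section \<open>Monotone subsets and betweenness in several orders\<close>

text \<open>Label x by the size \<open>A x\<close> of a largest nondecreasing set ending at x. If no
  such set has more than m elements, the pigeonhole principle gives more than m elements with a
  common label. On these f is decreasing: if x < y and f x \<le> f y, appending y to a set ending at
  x would raise the label.\<close>

lemma erdos_szekeres:
  fixes f :: "nat \<Rightarrow> 'b::linorder"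
  assumes fin: "finite T" and card: "m * m < card T"
  obtains U where "U \<subseteq> T" "m < card U" "mono_on U f \<or> antimono_on U f"
proof (cases "\<exists>U \<subseteq> T. m < card U \<and> mono_on U f")
  case True
  then show ?thesis using that by blast
next
  case False
  define C where "C x = {U. U \<subseteq> T \<and> x \<in> U \<and> (\<forall>y\<in>U. y \<le> x) \<and> mono_on U f}" for x
  define A where "A x = Max (card ` C x)" for x
  have finC: "finite (C x)" for x
    by (rule finite_subset[of _ "Pow T"]) (auto simp: C_def fin)
  have sing: "{x} \<in> C x" if "x \<in> T" for x
    using that by (auto simp: C_def monotone_on_def)
  have A_in: "A x \<in> {1..m}" if x: "x \<in> T" for x
  proof -
    have "A x \<in> card ` C x"
      unfolding A_def using finC sing[OF x] by (intro Max_in) auto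
    then obtain U where U: "U \<in> C x" "A x = card U" by auto
    have "card {x} \<le> A x"
      unfolding A_def using finC sing[OF x] by (intro Max_ge finite_imageI imageI)
    moreover have "card U \<le> m"
      using False U(1) by (auto simp: C_def not_less)
    ultimately show ?thesis using U(2) by simp
  qed
  have A_less: "A x < A y" if xy: "x \<in> T" "y \<in> T" "x < y" "f x \<le> f y" for x y
  proof -
    have "A x \<in> card ` C x"
      unfolding A_def using finC sing[OF xy(1)] by (intro Max_in) auto
    then obtain U where U: "U \<in> C x" "A x = card U" by auto
    have "finite U" using U(1) fin by (auto simp: C_def intro: finite_subset)
    moreover have "y \<notin> U" using U(1) xy(3) by (auto simp: C_def)
    moreover have "insert y U \<in> C y"
      using U(1) xy by (force simp: C_def monotone_on_def intro: order_trans)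
    then have "card (insert y U) \<le> A y"
      unfolding A_def using finC by (intro Max_ge) auto
    ultimately show ?thesis using U(2) by simp
  qed
  have "\<exists>i\<in>{1..m}. m < card {x \<in> T. A x = i}"
  proof (rule ccontr)
    assume "\<not> ?thesis"
    then have le: "card {x \<in> T. A x = i} \<le> m" if "i \<in> {1..m}" for i
      using that by (auto simp: not_less)
    have "T = (\<Union>i\<in>{1..m}. {x \<in> T. A x = i})" using A_in by auto
    then have "card T \<le> (\<Sum>i\<in>{1..m}. card {x \<in> T. A x = i})"
      by (metis card_UN_le finite_atLeastAtMost)
    also have "\<dots> \<le> (\<Sum>i\<in>{1..m}. m)" by (rule sum_mono) (use le in auto)
    finally show False using card by simp
  qed
  then obtain i where i: "m < card {x \<in> T. A x = i}" by blast
  have "antimono_on {x \<in> T. A x = i} f"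
  proof (rule monotone_onI)
    fix x y assume *: "x \<in> {x \<in> T. A x = i}" "y \<in> {x \<in> T. A x = i}" "x \<le> y"
    show "f y \<le> f x"
    proof (cases "x = y")
      case False
      then show ?thesis using A_less[of x y] * by force
    qed simp
  qed
  then show ?thesis using i that[of "{x \<in> T. A x = i}"] by auto
qed

text \<open>Each function costs a square root of the size, and \<open>2 ^ 2 ^ Suc k\<close> is the
  square of \<open>2 ^ 2 ^ k\<close>. Monotonicity once obtained survives passing to smaller sets.
  When no function is left, more than \<open>2 ^ 2 ^ 0 = 2\<close> elements remain.\<close>

lemma erdos_szekeres_iterated:
  fixes f :: "nat \<Rightarrow> nat \<Rightarrow> 'b::linorder"
  assumes "finite T" "2 ^ 2 ^ k < card T"
  shows "\<exists>U \<subseteq> T. 2 < card U \<and> (\<forall>d<k. mono_on U (f d) \<or> antimono_on U (f d))"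
  using assms
proof (induction k arbitrary: T)
  case 0
  then show ?case by auto
next
  case (Suc k)
  have "(2::nat) ^ 2 ^ Suc k = 2 ^ 2 ^ k * 2 ^ 2 ^ k"
    by (simp add: power_add[symmetric] mult_2)
  then obtain T' where T': "T' \<subseteq> T" "2 ^ 2 ^ k < card T'" "mono_on T' (f k) \<or> antimono_on T' (f k)"
    using erdos_szekeres[of T "2 ^ 2 ^ k" "f k"] Suc.prems by metis
  obtain U where U: "U \<subseteq> T'" "2 < card U" "\<forall>d<k. mono_on U (f d) \<or> antimono_on U (f d)"
    using Suc.IH[of T'] T' Suc.prems(1) finite_subset by metis
  have "mono_on U (f k) \<or> antimono_on U (f k)"
    using T'(3) U(1) monotone_on_subset by blast
  then show ?case using U T'(1) by (metis less_Suc_eq subset_trans)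
qed

lemma three_increasing:
  fixes U :: "nat set"
  assumes "2 < card U"
  obtains x y z where "x \<in> U" "y \<in> U" "z \<in> U" "x < y" "y < z"
proof -
  have fin: "finite U" using assms card_gt_0_iff by force
  have ne: "U \<noteq> {}" using assms by auto
  have c: "card (U - {Min U}) > 1" using fin ne assms by (simp add: card_Diff_singleton)
  then have ne2: "U - {Min U} \<noteq> {}" by force
  have c2: "card (U - {Min U} - {Max U}) > 0"
    using c fin by (simp add: card_Diff_singleton_if)
  then obtain y where y: "y \<in> U - {Min U} - {Max U}" by (metis card_gt_0_iff equals0I)
  then have "Min U < y" "y < Max U" using fin by (auto simp: le_neq_trans)
  then show ?thesis using that[of "Min U" y "Max U"] y fin ne by auto
qed

lemma exists_between_in_all_orders:
  fixes f :: "nat \<Rightarrow> 'a \<Rightarrow> 'b::linorder"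
  assumes fin: "finite S" and card: "2 ^ 2 ^ k < card S"
  obtains x y z where "x \<in> S" "y \<in> S" "z \<in> S" "x \<noteq> y" "y \<noteq> z" "x \<noteq> z"
    "\<And>d. d \<le> k \<Longrightarrow> min (f d x) (f d z) \<le> f d y \<and> f d y \<le> max (f d x) (f d z)"
proof -
  obtain ys where ys: "set ys = S" "distinct ys" using finite_distinct_list[OF fin] by blast
  \<comment> \<open>Listing S by \<open>f k\<close> makes this function monotone in the index for
    free, so only the k functions before it reduce the set.\<close>
  define xs where "xs = sort_key (f k) ys"
  have xs: "set xs = S" "distinct xs" "sorted (map (f k) xs)"
    using ys by (auto simp: xs_def)
  have len: "length xs = card S" using xs distinct_card by metis
  define g where "g d i = f d (xs ! i)" for d i
  have gk: "g k i \<le> g k j" if "i \<le> j" "j < card S" for i j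
    using xs(3) that len by (auto simp: g_def sorted_iff_nth_mono)
  obtain U where U: "U \<subseteq> {..<card S}" "2 < card U"
      "\<forall>d<k. mono_on U (g d) \<or> antimono_on U (g d)"
    using erdos_szekeres_iterated[of "{..<card S}" k g] card by auto
  obtain i j l where ijl: "i \<in> U" "j \<in> U" "l \<in> U" "i < j" "j < l"
    using three_increasing[OF U(2)] by blast
  have lt: "i < card S" "j < card S" "l < card S" using U(1) ijl by auto
  have "min (g d i) (g d l) \<le> g d j \<and> g d j \<le> max (g d i) (g d l)" if "d \<le> k" for d
  proof (cases "d = k")
    case True
    then show ?thesis using gk[of i j] gk[of j l] ijl lt by (auto simp: le_max_iff_disj min_le_iff_disj)
  next
    case False
    then have "mono_on U (g d) \<or> antimono_on U (g d)" using U(3) that by auto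
    then have "g d i \<le> g d j \<and> g d j \<le> g d l \<or> g d l \<le> g d j \<and> g d j \<le> g d i"
      using ijl by (auto simp: monotone_on_def)
    then show ?thesis by (auto simp: le_max_iff_disj min_le_iff_disj)
  qed
  moreover have "xs ! i \<noteq> xs ! j" "xs ! j \<noteq> xs ! l" "xs ! i \<noteq> xs ! l"
    using xs(2) len lt ijl by (auto simp: nth_eq_iff_index_eq)
  moreover have "xs ! i \<in> S" "xs ! j \<in> S" "xs ! l \<in> S" using lt len xs(1) by (metis nth_mem)+
  ultimately show ?thesis using that[of "xs ! i" "xs ! j" "xs ! l"] by (auto simp: g_def)
qed

section \<open>Placements on the line that separate triples\<close>

text \<open>
  Numbers below \<open>Q\<^sup>2\<close> are pairs of digits in base \<open>Q = 2 ^ 2 ^ m\<close>.  The old placements are applied to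
  both digits; the new one reverses the low digit only.
\<close>

lemma separating_maps_less:
  "\<exists>\<sigma> :: nat \<Rightarrow> nat \<Rightarrow> nat. (\<forall>t<m. \<forall>x < 2 ^ 2 ^ m. \<sigma> t x < 2 ^ 2 ^ m) \<and>
    (\<forall>i l j. i < l \<longrightarrow> l < j \<longrightarrow> j < 2 ^ 2 ^ m \<longrightarrow>
      (\<exists>t<m. \<sigma> t l < min (\<sigma> t i) (\<sigma> t j) \<or> max (\<sigma> t i) (\<sigma> t j) < \<sigma> t l))"
proof (induction m)
  \<comment> \<open>Since \<open>2 ^ 2 ^ 0 = 2\<close>, there is no triple to separate.\<close>
  case 0
  show ?case by auto
next
  case (Suc m)
  define Q :: nat where "Q = 2 ^ 2 ^ m"
  have Q: "0 < Q" by (simp add: Q_def)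
  have QQ: "2 ^ 2 ^ Suc m = Q * Q" by (simp add: Q_def power_add[symmetric] mult_2)
  obtain \<sigma> :: "nat \<Rightarrow> nat \<Rightarrow> nat" where
    bound: "\<And>t x. t < m \<Longrightarrow> x < Q \<Longrightarrow> \<sigma> t x < Q" and
    sep: "\<And>i l j. i < l \<Longrightarrow> l < j \<Longrightarrow> j < Q \<Longrightarrow>
      (\<exists>t<m. \<sigma> t l < min (\<sigma> t i) (\<sigma> t j) \<or> max (\<sigma> t i) (\<sigma> t j) < \<sigma> t l)"
    using Suc.IH unfolding Q_def by blast
  \<comment> \<open>The bound on \<sigma> carried through the induction keeps
    \<open>\<sigma> t (x mod Q)\<close> a valid low digit, so values of \<tau> compare
    lexicographically.\<close>
  define \<tau> where "\<tau> t x = (if t < m then Q * \<sigma> t (x div Q) + \<sigma> t (x mod Q)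
    else Q * (x div Q) + (Q - 1 - x mod Q))" for t x
  have digits: "Q * p + q < Q * p' + q'" if "p < p'" "q < Q" for p q p' q' :: nat
  proof -
    have "Q * p + q < Q * Suc p" using that by simp
    also have "\<dots> \<le> Q * p'" using that by (intro mult_le_mono) auto
    finally show ?thesis by simp
  qed
  have modQ: "x mod Q < Q" for x using Q by simp
  have divQ: "x div Q < Q" if "x < Q * Q" for x using that by (simp add: less_mult_imp_div_less)
  have old: "\<exists>t < Suc m. \<tau> t l < min (\<tau> t i) (\<tau> t j) \<or> max (\<tau> t i) (\<tau> t j) < \<tau> t l"
    if ord: "i < l" "l < j" "j < Q * Q" for i l j
  proof -
    have le: "i div Q \<le> l div Q" "l div Q \<le> j div Q" using ord by (auto intro: div_le_mono)
    have eq: "x = Q * (x div Q) + x mod Q" for x by simp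
    consider "i div Q < l div Q" "l div Q < j div Q" | "i div Q = l div Q" "l div Q = j div Q"
      | "i div Q = l div Q" "l div Q < j div Q" | "i div Q < l div Q" "l div Q = j div Q"
      using le by linarith
    then show ?thesis
    proof cases
      case 1
      then obtain t where t: "t < m" "\<sigma> t (l div Q) < min (\<sigma> t (i div Q)) (\<sigma> t (j div Q)) \<or>
          max (\<sigma> t (i div Q)) (\<sigma> t (j div Q)) < \<sigma> t (l div Q)"
        using sep divQ ord(3) by blast
      have "\<sigma> t (i mod Q) < Q" "\<sigma> t (l mod Q) < Q" "\<sigma> t (j mod Q) < Q"
        using bound t(1) modQ by auto
      then show ?thesis using t digits by (intro exI[of _ t]) (auto simp: \<tau>_def)
    next
      case 2
      then have "i mod Q < l mod Q" "l mod Q < j mod Q"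
        using ord eq[of i] eq[of l] eq[of j] by (metis add_less_cancel_left)+
      then obtain t where "t < m" "\<sigma> t (l mod Q) < min (\<sigma> t (i mod Q)) (\<sigma> t (j mod Q)) \<or>
          max (\<sigma> t (i mod Q)) (\<sigma> t (j mod Q)) < \<sigma> t (l mod Q)"
        using sep modQ by blast
      then show ?thesis using 2 by (intro exI[of _ t]) (auto simp: \<tau>_def)
    next
      \<comment> \<open>Reversing the low digit moves l below i, while the high digit keeps j above
        l. Case 4 is the mirror image, with l on top. \<open>modQ\<close> ensures that the truncated
        subtraction in \<tau> is strict.\<close>
      case 3
      then have "i mod Q < l mod Q"
        using ord eq[of i] eq[of l] by (metis add_less_cancel_left)
      then have "\<tau> m l < \<tau> m i" using 3 modQ[of l] by (simp add: \<tau>_def)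
      moreover have "\<tau> m l < \<tau> m j" using 3 digits Q by (simp add: \<tau>_def)
      ultimately show ?thesis by (intro exI[of _ m]) auto
    next
      case 4
      then have "l mod Q < j mod Q"
        using ord eq[of j] eq[of l] by (metis add_less_cancel_left)
      then have "\<tau> m j < \<tau> m l" using 4 modQ[of j] by (simp add: \<tau>_def)
      moreover have "\<tau> m i < \<tau> m l" using 4 digits Q by (simp add: \<tau>_def)
      ultimately show ?thesis by (intro exI[of _ m]) auto
    qed
  qed
  have "\<tau> t x < Q * Q" if "x < Q * Q" for t x
  proof -
    have *: "Q * p + q < Q * Q" if "p < Q" "q < Q" for p q
      \<comment> \<open>The bound \<open>Q * Q\<close> is itself read as high digit \<open>Q\<close>
        and low digit \<open>0\<close>.\<close>
      using digits[of p Q q 0] that by simp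
    show ?thesis using * bound modQ divQ[OF that] Q by (auto simp: \<tau>_def)
  qed
  then show ?case unfolding QQ using old by (intro exI[of _ \<tau>]) blast
qed

text \<open>The identity, added as map number m, separates l when it lies outside the hull of i and
  j; otherwise l lies strictly between them and the earlier maps apply, whichever of i and j is
  smaller. That map m is the identity is recorded because it gives distinct vertices distinct
  positions.\<close>

lemma separating_maps:
  obtains \<tau> :: "nat \<Rightarrow> nat \<Rightarrow> nat" where "\<And>x. \<tau> m x = x"
    "\<And>i l j. \<lbrakk>i < 2 ^ 2 ^ m; l < 2 ^ 2 ^ m; j < 2 ^ 2 ^ m; l \<noteq> i; l \<noteq> j\<rbrakk> \<Longrightarrow>
      \<exists>t\<le>m. \<tau> t l < min (\<tau> t i) (\<tau> t j) \<or> max (\<tau> t i) (\<tau> t j) < \<tau> t l"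
proof -
  obtain \<sigma> :: "nat \<Rightarrow> nat \<Rightarrow> nat" where
    sep: "\<And>i l j. i < l \<Longrightarrow> l < j \<Longrightarrow> j < 2 ^ 2 ^ m \<Longrightarrow>
      \<exists>t<m. \<sigma> t l < min (\<sigma> t i) (\<sigma> t j) \<or> max (\<sigma> t i) (\<sigma> t j) < \<sigma> t l"
    using separating_maps_less[of m] by blast
  define \<tau> where "\<tau> t x = (if t = m then x else \<sigma> t x)" for t x
  have "\<exists>t\<le>m. \<tau> t l < min (\<tau> t i) (\<tau> t j) \<or> max (\<tau> t i) (\<tau> t j) < \<tau> t l"
    if "i < 2 ^ 2 ^ m" "l < 2 ^ 2 ^ m" "j < 2 ^ 2 ^ m" "l \<noteq> i" "l \<noteq> j" for i l j
  proof -
    consider "l < min i j \<or> max i j < l" | "i < l" "l < j" | "j < l" "l < i"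
      using \<open>l \<noteq> i\<close> \<open>l \<noteq> j\<close> by linarith
    then show ?thesis
    proof cases
      case 1
      then show ?thesis by (intro exI[of _ m]) (auto simp: \<tau>_def)
    next
      case 2
      then obtain t where "t < m" "\<sigma> t l < min (\<sigma> t i) (\<sigma> t j) \<or> max (\<sigma> t i) (\<sigma> t j) < \<sigma> t l"
        using sep \<open>j < 2 ^ 2 ^ m\<close> by blast
      then show ?thesis by (intro exI[of _ t]) (auto simp: \<tau>_def)
    next
      case 3
      then obtain t where "t < m" "\<sigma> t l < min (\<sigma> t j) (\<sigma> t i) \<or> max (\<sigma> t j) (\<sigma> t i) < \<sigma> t l"
        using sep \<open>i < 2 ^ 2 ^ m\<close> by blast
      then show ?thesis by (intro exI[of _ t]) (auto simp: \<tau>_def)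
    qed
  qed
  then show ?thesis using that[of \<tau>] by (simp add: \<tau>_def)
qed

section \<open>Box representations in terms of endpoints\<close>

definition interval_representation ::
    "nat \<Rightarrow> 'a pair_pre_digraph \<Rightarrow> ('a \<Rightarrow> nat \<Rightarrow> real) \<Rightarrow> ('a \<Rightarrow> nat \<Rightarrow> real) \<Rightarrow> bool" where
  "interval_representation k G a b \<longleftrightarrow>
    (\<forall>v \<in> pverts G. \<forall>i<k. a v i \<le> b v i) \<and>
    (\<forall>u \<in> pverts G. \<forall>v \<in> pverts G. u \<noteq> v \<longrightarrow>
       ((u, v) \<in> parcs G \<longleftrightarrow> (\<forall>i<k. a u i \<le> b v i \<and> a v i \<le> b u i)))"

text \<open>A product of intersections is empty iff some factor is. The condition
  \<open>max (a i) (c i) \<le> min (b i) (d i)\<close> splits into four inequalities, two of which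
  are the assumptions.\<close>

lemma boxes_meet_iff:
  fixes a b c d :: "nat \<Rightarrow> real"
  assumes "\<forall>i<k. a i \<le> b i" "\<forall>i<k. c i \<le> d i"
  shows "(\<Pi>\<^sub>E i\<in>{..<k}. {a i..b i}) \<inter> (\<Pi>\<^sub>E i\<in>{..<k}. {c i..d i}) \<noteq> {} \<longleftrightarrow>
    (\<forall>i<k. a i \<le> d i \<and> c i \<le> b i)"
  unfolding PiE_Int PiE_eq_empty_iff using assms by (auto simp: Int_atLeastAtMost)

lemma box_representation_iff_interval_representation:
  "(\<exists>R. box_representation k G R) \<longleftrightarrow> (\<exists>a b. interval_representation k G a b)"
proof
  assume "\<exists>R. box_representation k G R"
  then obtain R where R: "box_representation k G R" ..
  then have "\<forall>v\<in>pverts G. \<exists>a b. (\<forall>i<k. a i \<le> b i) \<and> R v = (\<Pi>\<^sub>E i\<in>{..<k}. {a i..b i})"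
    by (auto simp: box_representation_def is_box_def)
  then obtain a b where ab: "\<And>v. v \<in> pverts G \<Longrightarrow> \<forall>i<k. a v i \<le> b v i"
      "\<And>v. v \<in> pverts G \<Longrightarrow> R v = (\<Pi>\<^sub>E i\<in>{..<k}. {a v i..b v i})"
    by metis
  have "(u, v) \<in> parcs G \<longleftrightarrow> (\<forall>i<k. a u i \<le> b v i \<and> a v i \<le> b u i)"
    if "u \<in> pverts G" "v \<in> pverts G" "u \<noteq> v" for u v
    using R that boxes_meet_iff[OF ab(1)[OF that(1)] ab(1)[OF that(2)]]
    by (simp add: box_representation_def ab(2))
  then show "\<exists>a b. interval_representation k G a b"
    using ab(1) unfolding interval_representation_def by blast
next
  assume "\<exists>a b. interval_representation k G a b"
  then obtain a b where ab: "interval_representation k G a b" by blast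
  define R where "R v = (\<Pi>\<^sub>E i\<in>{..<k}. {a v i..b v i})" for v
  have "box_representation k G R"
    unfolding box_representation_def R_def
  proof (intro conjI ballI impI)
    show "is_box k (\<Pi>\<^sub>E i\<in>{..<k}. {a v i..b v i})" if "v \<in> pverts G" for v
      using ab that by (auto simp: interval_representation_def is_box_def)
    fix u v assume uv: "u \<in> pverts G" "v \<in> pverts G" "u \<noteq> v"
    show "(u, v) \<in> parcs G \<longleftrightarrow>
        (\<Pi>\<^sub>E i\<in>{..<k}. {a u i..b u i}) \<inter> (\<Pi>\<^sub>E i\<in>{..<k}. {a v i..b v i}) \<noteq> {}"
      using ab uv boxes_meet_iff[of k "a u" "b u" "a v" "b v"]
      by (simp add: interval_representation_def)
  qed
  then show "\<exists>R. box_representation k G R" by auto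
qed

section \<open>The fully subdivided complete graph\<close>

text \<open>Fixing the witness \<open>w\<close> of \<open>full_subdivision\<close> allows case
  distinctions between original vertices and vertices \<open>w e\<close>.\<close>

locale subdivided_complete_graph =
  fixes V :: "'a set" and w :: "'a set \<Rightarrow> 'a" and E :: "'a set set" and G :: "'a pair_pre_digraph"
  assumes finite_V: "finite V"
    and E_eq: "E = {{u, v} | u v. u \<in> V \<and> v \<in> V \<and> u \<noteq> v}"
    and inj_w: "inj_on w E"
    and disjoint: "w ` E \<inter> V = {}"
    and verts: "pverts G = V \<union> w ` E"
    and arcs: "parcs G = (\<Union>e \<in> E. e \<times> {w e} \<union> {w e} \<times> e)"
begin

lemma edge_subset: "e \<in> E \<Longrightarrow> e \<subseteq> V"
  by (auto simp: E_eq)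

lemma w_notin: "e \<in> E \<Longrightarrow> w e \<notin> V"
  using disjoint by blast

lemma arc_sym: "(x, y) \<in> parcs G \<longleftrightarrow> (y, x) \<in> parcs G"
  by (auto simp: arcs)

lemma arc_vertex_edge: "v \<in> V \<Longrightarrow> e \<in> E \<Longrightarrow> (v, w e) \<in> parcs G \<longleftrightarrow> v \<in> e"
  using w_notin edge_subset inj_w by (auto simp: arcs dest: inj_onD)

lemma no_arc_vertices: "u \<in> V \<Longrightarrow> v \<in> V \<Longrightarrow> (u, v) \<notin> parcs G"
  using w_notin by (auto simp: arcs)

lemma no_arc_edges: "e \<in> E \<Longrightarrow> e' \<in> E \<Longrightarrow> (w e, w e') \<notin> parcs G"
  using w_notin edge_subset by (fastforce simp: arcs)

section \<open>Endpoint orders bound the number of original vertices\<close>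

lemma card_le_of_interval_representation:
  assumes rep: "interval_representation k G a b" and k: "0 < k"
  shows "card V \<le> 2 ^ 2 ^ (2 * k - 1)"
proof (rule ccontr)
  assume "\<not> ?thesis"
  then have many: "2 ^ 2 ^ (2 * k - 1) < card V" by simp
  \<comment> \<open>The orders are numbered from \<open>0\<close> to \<open>2 * k - 1\<close>, left
    endpoints first, to fit the range \<open>d \<le> 2 * k - 1\<close> of the betweenness
    lemma.\<close>
  define F where "F d v = (if d < k then a v d else b v (d - k))" for d v
  obtain x y z where xyz: "x \<in> V" "y \<in> V" "z \<in> V" "x \<noteq> y" "y \<noteq> z" "x \<noteq> z"
    and between: "\<And>d. d \<le> 2 * k - 1 \<Longrightarrow>
      min (F d x) (F d z) \<le> F d y \<and> F d y \<le> max (F d x) (F d z)"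
    using exists_between_in_all_orders[OF finite_V many, of F] by blast
  let ?e = "{x, z}"
  have e: "?e \<in> E" using xyz by (auto simp: E_eq)
  have meet: "a v i \<le> b (w ?e) i" "a (w ?e) i \<le> b v i" if "v \<in> {x, z}" "i < k" for v i
  proof -
    have "v \<in> V" using that xyz by auto
    then have "(v, w ?e) \<in> parcs G" "v \<noteq> w ?e"
      using arc_vertex_edge[OF _ e] that w_notin[OF e] by auto
    then have "a v i \<le> b (w ?e) i \<and> a (w ?e) i \<le> b v i"
      using rep that(2) \<open>v \<in> V\<close> e unfolding interval_representation_def verts by blast
    then show "a v i \<le> b (w ?e) i" "a (w ?e) i \<le> b v i" by auto
  qed
  have "a y i \<le> b (w ?e) i \<and> a (w ?e) i \<le> b y i" if i: "i < k" for i
  proof -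
    \<comment> \<open>In coordinate i, y starts no later than x or z does, hence before the edge box
      ends. Dually, y ends no earlier than x or z does, hence after the edge box starts.\<close>
    have "a y i \<le> max (a x i) (a z i)" using between[of i] i by (simp add: F_def)
    moreover have "min (b x i) (b z i) \<le> b y i" using between[of "i + k"] i by (simp add: F_def)
    ultimately show ?thesis
      using meet[of x i] meet[of z i] i by (auto simp: le_max_iff_disj min_le_iff_disj)
  qed
  moreover have "y \<noteq> w ?e" using w_notin[OF e] xyz by auto
  ultimately have "(y, w ?e) \<in> parcs G"
    using rep xyz(2) e unfolding interval_representation_def verts by blast
  then show False using arc_vertex_edge[OF xyz(2) e] xyz by auto
qed

section \<open>Constructing a representation from separating placements\<close>

lemma interval_representation_exists:
  assumes card: "card V \<le> 2 ^ 2 ^ m"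
  shows "\<exists>a b. interval_representation (m + 2) G a b"
proof -
  obtain \<tau> :: "nat \<Rightarrow> nat \<Rightarrow> nat" where \<tau>m: "\<And>x. \<tau> m x = x"
    and \<tau>: "\<And>i l j. \<lbrakk>i < 2 ^ 2 ^ m; l < 2 ^ 2 ^ m; j < 2 ^ 2 ^ m; l \<noteq> i; l \<noteq> j\<rbrakk> \<Longrightarrow>
      \<exists>t\<le>m. \<tau> t l < min (\<tau> t i) (\<tau> t j) \<or> max (\<tau> t i) (\<tau> t j) < \<tau> t l"
    using separating_maps[of m] by blast
  obtain f where f: "bij_betw f V {0..<card V}"
    using ex_bij_betw_finite_nat[OF finite_V] by blast
  have f_less: "f v < 2 ^ 2 ^ m" if "v \<in> V" for v
    using f that card by (fastforce dest: bij_betwE)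
  have f_inj: "f u = f v \<longleftrightarrow> u = v" if "u \<in> V" "v \<in> V" for u v
    using f that by (auto simp: bij_betw_def dest: inj_onD)
  have "finite E"
    by (rule finite_subset[of _ "Pow V"]) (use edge_subset finite_V in auto)
  then obtain g :: "'a set \<Rightarrow> nat" and N where g: "g ` E = {i. i < N}" "inj_on g E"
    using finite_imp_inj_to_nat_seg[OF \<open>finite E\<close>] by metis
  define pos where "pos t v = real (\<tau> t (f v))" for t v
  define ed where "ed = the_inv_into E w"
  have ed: "ed (w e) = e" if "e \<in> E" for e
    using that inj_w by (simp add: ed_def the_inv_into_f_f)
  \<comment> \<open>In the last dimension \<open>m + 1\<close> an original vertex gets the whole
    interval from 0 to \<open>N\<close>, which contains the points \<open>g e\<close> of all edges.
    So this dimension separates distinct edges and never a vertex from an edge.\<close>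
  define a where "a x t = (if x \<in> V then (if t \<le> m then pos t x else 0)
    else (if t \<le> m then Min (pos t ` ed x) else real (g (ed x))))" for x t
  define b where "b x t = (if x \<in> V then (if t \<le> m then pos t x else real N)
    else (if t \<le> m then Max (pos t ` ed x) else real (g (ed x))))" for x t
  define meet where "meet x y \<longleftrightarrow> (\<forall>t<m + 2. a x t \<le> b y t \<and> a y t \<le> b x t)" for x y
  have meet_sym: "meet x y \<longleftrightarrow> meet y x" for x y by (auto simp: meet_def)
  have VV: "\<not> meet u v" if "u \<in> V" "v \<in> V" "u \<noteq> v" for u v
  proof -
    \<comment> \<open>Placement m is the identity and f is injective on V, so dimension m separates
      the original vertices.\<close>
    have "a u m \<noteq> a v m" using that by (simp add: a_def pos_def \<tau>m f_inj)
    moreover have "a u m = b u m" "a v m = b v m" using that by (auto simp: a_def b_def)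
    ultimately show ?thesis unfolding meet_def by (intro notI) (drule spec[of _ m], auto)
  qed
  have WW: "\<not> meet (w e) (w e')" if "e \<in> E" "e' \<in> E" "w e \<noteq> w e'" for e e'
  proof -
    have "g e \<noteq> g e'" using that g(2) by (auto dest: inj_onD)
    then show ?thesis using that
      unfolding meet_def by (intro notI) (drule spec[of _ "m + 1"], auto simp: a_def b_def w_notin ed)
  qed
  have VW: "meet v (w e) \<longleftrightarrow> v \<in> e" if v: "v \<in> V" and e: "e \<in> E" for v e
  proof -
    obtain p q where pq: "e = {p, q}" "p \<in> V" "q \<in> V" using e by (auto simp: E_eq)
    have last: "a v (m + 1) \<le> b (w e) (m + 1) \<and> a (w e) (m + 1) \<le> b v (m + 1)"
      using g(1) v e by (auto simp: a_def b_def w_notin ed intro: less_imp_le)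
    have "meet v (w e) \<longleftrightarrow> (\<forall>t\<le>m. a v t \<le> b (w e) t \<and> a (w e) t \<le> b v t)"
    proof -
      have "t < m + 2 \<longleftrightarrow> t \<le> m \<or> t = m + 1" for t by auto
      then show ?thesis using last unfolding meet_def by blast
    qed
    also have "\<dots> \<longleftrightarrow> (\<forall>t\<le>m. pos t v \<le> max (pos t p) (pos t q) \<and> min (pos t p) (pos t q) \<le> pos t v)"
      using v e by (simp add: a_def b_def w_notin ed) (simp add: pq(1))
    also have "\<dots> \<longleftrightarrow> v \<in> e"
    proof
      assume *: "\<forall>t\<le>m. pos t v \<le> max (pos t p) (pos t q) \<and> min (pos t p) (pos t q) \<le> pos t v"
      show "v \<in> e"
      proof (rule ccontr)
        assume "v \<notin> e"
        then have "f v \<noteq> f p" "f v \<noteq> f q" using pq v by (auto simp: f_inj)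
        then obtain t where "t \<le> m" "\<tau> t (f v) < min (\<tau> t (f p)) (\<tau> t (f q)) \<or>
            max (\<tau> t (f p)) (\<tau> t (f q)) < \<tau> t (f v)"
          using \<tau> f_less v pq by blast
        then show False using * unfolding pos_def by fastforce
      qed
    qed (auto simp: pq(1))
    finally show ?thesis .
  qed
  have "a x t \<le> b x t" if "x \<in> pverts G" for x t
  proof (cases "x \<in> V")
    case False
    then obtain e where e: "e \<in> E" "x = w e" using \<open>x \<in> pverts G\<close> by (auto simp: verts)
    then obtain p q where "e = {p, q}" by (auto simp: E_eq)
    then show ?thesis using e by (simp add: a_def b_def w_notin ed min_le_iff_disj le_max_iff_disj)
  qed (simp add: a_def b_def)
  moreover have "(x, y) \<in> parcs G \<longleftrightarrow> meet x y"
    if xy: "x \<in> pverts G" "y \<in> pverts G" "x \<noteq> y" for x y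
  proof -
    consider "x \<in> V" "y \<in> V" | e where "x \<in> V" "e \<in> E" "y = w e"
      | e where "e \<in> E" "x = w e" "y \<in> V"
      | e e' where "e \<in> E" "x = w e" "e' \<in> E" "y = w e'"
      using xy unfolding verts by blast
    then show ?thesis
    proof cases
      case 1
      then show ?thesis using VV no_arc_vertices xy(3) by blast
    next
      case 2
      then show ?thesis using VW arc_vertex_edge by blast
    next
      case 3
      then show ?thesis using VW arc_vertex_edge meet_sym arc_sym by metis
    next
      case 4
      then show ?thesis using WW no_arc_edges xy(3) by blast
    qed
  qed
  ultimately have "interval_representation (m + 2) G a b"
    unfolding interval_representation_def meet_def by blast
  then show ?thesis by blast
qed

lemma boxicity_le:
  assumes "card V \<le> 2 ^ 2 ^ m"
  shows "boxicity G \<le> m + 2"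
  unfolding boxicity_def box_representation_iff_interval_representation
  by (rule Least_le) (use interval_representation_exists[OF assms] in auto)

text \<open>The assumption on m supplies some representation, so the least dimension in
  \<open>boxicity\<close> is attained and the bound for representations applies to it.\<close>

lemma card_le_boxicity:
  assumes "card V \<le> 2 ^ 2 ^ m"
  shows "0 < boxicity G" "card V \<le> 2 ^ 2 ^ (2 * boxicity G - 1)"
proof -
  have "0 < boxicity G \<and> (\<exists>a b. interval_representation (boxicity G) G a b)"
    unfolding boxicity_def box_representation_iff_interval_representation
    by (rule LeastI[of _ "m + 2"]) (use interval_representation_exists[OF assms] in auto)
  then show "0 < boxicity G" "card V \<le> 2 ^ 2 ^ (2 * boxicity G - 1)"
    using card_le_of_interval_representation by blast+
qed

end

section \<open>Double logarithms and the final estimate\<close>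

text \<open>Exponentiate twice. The assumption makes the inner logarithm at least 1, so the outer
  one has a positive argument.\<close>

lemma ceiling_loglog_le_iff:
  fixes n m :: nat
  assumes "2 \<le> n"
  shows "\<lceil>log 2 (log 2 (real n))\<rceil> \<le> int m \<longleftrightarrow> n \<le> 2 ^ 2 ^ m"
proof -
  have pos: "1 \<le> log 2 (real n)" using assms by simp
  have "\<lceil>log 2 (log 2 (real n))\<rceil> \<le> int m \<longleftrightarrow> log 2 (log 2 (real n)) \<le> real m"
    by (simp add: ceiling_le_iff)
  also have "\<dots> \<longleftrightarrow> log 2 (real n) \<le> real (2 ^ m)"
    using pos by (subst log_le_iff) (auto simp: powr_realpow)
  also have "\<dots> \<longleftrightarrow> real n \<le> 2 powr real (2 ^ m)"
    using assms by (subst log_le_iff) auto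
  also have "\<dots> \<longleftrightarrow> real n \<le> real (2 ^ 2 ^ m)"
    by (subst powr_realpow) auto
  finally show ?thesis by (simp only: of_nat_le_iff)
qed

theorem theorem1:
  fixes n :: nat and H G :: "'a pair_pre_digraph"
  assumes "n \<ge> 2"
    and "complete_digraph n (with_proj H)"
    and "full_subdivision H G"
  shows "(real_of_int \<lceil>log 2 (log 2 (real n))\<rceil> + 1) / 2 \<le> real (boxicity G) \<and>
    real (boxicity G) \<le> real_of_int \<lceil>log 2 (log 2 (real n))\<rceil> + 2"
proof -
  have H: "finite (pverts H)" "card (pverts H) = n"
      "parcs H = {(u, v). u \<in> pverts H \<and> v \<in> pverts H \<and> u \<noteq> v}"
    using assms(2) unfolding complete_digraph_pair_def by auto
  obtain w where w: "inj_on w (uedges H)" "w ` uedges H \<inter> pverts H = {}"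
      "pverts G = pverts H \<union> w ` uedges H"
      "parcs G = (\<Union>e \<in> uedges H. e \<times> {w e} \<union> {w e} \<times> e)"
    using assms(3) unfolding full_subdivision_def by blast
  interpret subdivided_complete_graph "pverts H" w "uedges H" G
    by unfold_locales (use H w in \<open>auto simp: uedges_def\<close>)
  let ?c = "\<lceil>log 2 (log 2 (real n))\<rceil>"
  have "0 \<le> log 2 (log 2 (real n))" using assms(1) by simp
  then have c: "0 \<le> ?c" by (simp add: le_ceiling_iff)
  \<comment> \<open>As \<open>?c\<close> is nonnegative, \<open>nat ?c\<close> loses nothing and can
    serve as m in the upper bound.\<close>
  then have card: "card (pverts H) \<le> 2 ^ 2 ^ nat ?c"
    using ceiling_loglog_le_iff[OF assms(1), of "nat ?c"] H(2) by simp
  \<comment> \<open>Here the equivalence is used with \<open>2 * boxicity G - 1\<close> for m.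
    Positivity of the boxicity then makes this subtraction exact, which yields the summand 1 in the
    lower bound.\<close>
  have "?c \<le> int (2 * boxicity G - 1)"
    using card_le_boxicity(2)[OF card] ceiling_loglog_le_iff[OF assms(1)] H(2) by simp
  then have "?c + 1 \<le> 2 * int (boxicity G)"
    using card_le_boxicity(1)[OF card] by linarith
  then have "real_of_int (?c + 1) \<le> real_of_int (2 * int (boxicity G))"
    by (simp only: of_int_le_iff)
  moreover have "int (boxicity G) \<le> ?c + 2"
    using boxicity_le[OF card] c by linarith
  then have "real_of_int (int (boxicity G)) \<le> real_of_int (?c + 2)"
    by (simp only: of_int_le_iff)
  ultimately show ?thesis by simp
qed

end
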